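(* Let $f:\mathbf{R}^n \to \mathbf{R}\cup\{\infty\}$ be a symmetric convex function, not identically $\infty$, and let $F:\mathbf{S}^n\to\mathbf{R}\cup\{\infty\}$ be the corresponding spectral function, $F(X)=f(\boldsymbol{\lambda}(X))$. Let $K_F\subseteq \mathbf{R}\times\mathbf{R}\times\mathbf{S}^n$ and $K_f\subseteq\mathbf{R}\times\mathbf{R}\times\mathbf{R}^n$ be the associated spectral matrix cone and spectral vector cone. Let $(\bar t,\bar v,\bar X)\in\mathbf{R}\times\mathbf{R}\times\mathbf{S}^n$, where $\bar X$ has eigenvalue decomposition $\bar X = U\,\mathrm{diag}(\bar\lambda)\,U^T$ with $U\in\mathbf{R}^{n\times n}$ orthogonal and $\bar\lambda\in\mathbf{R}^n$. Then $$ \begin{aligned} \Pi_{K_F}(\bar t,\bar v,\bar X)_1 &= \Pi_{K_f}(\bar t,\bar v,\bar\lambda)_1,\\ \Pi_{K_F}(\bar t,\bar v,\bar X)_2 &= \Pi_{K_f}(\bar t,\bar v,\bar\lambda)_2,\\ \Pi_{K_F}(\bar t,\bar v,\bar X)_3 &= U\,\mathrm{diag}\big(\Pi_{K_f}(\bar t,\bar v,\bar\lambda)_3\big)\,U^T, \end{aligned} $$ where the subscripts $1,2,3$ denote the first, second and last components of the projections, which lie in $\mathbf{R}$, $\mathbf{R}$, $\mathbf{S}^n$ for $\Pi_{K_F}$ and in $\mathbf{R}$, $\mathbf{R}$, $\mathbf{R}^n$ for $\Pi_{K_f}$.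
   Context: $\mathbf{S}^n$ is the space of real symmetric $n\times n$ matrices and $\mathbf{R}_{++}=(0,\infty)$. For $X\in\mathbf{S}^n$, $\boldsymbol{\lambda}(X)=(\lambda_1(X),\dots,\lambda_n(X))\in\mathbf{R}^n$ is the vector of eigenvalues of $X$ in nonincreasing order. For $x\in\mathbf{R}^n$, $\mathrm{diag}(x)$ is the diagonal matrix with diagonal $x$. A function $f:\mathbf{R}^n\to\mathbf{R}\cup\{\infty\}$ is symmetric if $f(x)=f(Px)$ for all $x$ and all permutation matrices $P\in\mathbf{R}^{n\times n}$. A function $F:\mathbf{S}^n\to\mathbf{R}\cup\{\infty\}$ is spectral if $F(X)=F(UXU^T)$ for all $X$ and all orthogonal $U\in\mathbf{R}^{n\times n}$. The (convex) spectral function corresponding to a symmetric convex $f$ is $F(X)=f(\boldsymbol{\lambda}(X))$. The spectral matrix cone of $F$ and the spectral vector cone of $f$ are the closed convex cones $$K_F=\mathrm{cl}\{(t,v,X)\in\mathbf{R}\times\mathbf{R}_{++}\times\mathbf{S}^n \mid vF(X/v)\le t\},$$ $$K_f=\mathrm{cl}\{(t,v,x)\in\mathbf{R}\times\mathbf{R}_{++}\times\mathbf{R}^n \mid vf(x/v)\le t\},$$ where $\mathrm{cl}$ denotes closure (in $\mathbf{R}\times\mathbf{R}\times\mathbf{S}^n$ and $\mathbf{R}\times\mathbf{R}\times\mathbf{R}^n$, respectively). $\Pi_{K_F}(\bar t,\bar v,\bar X)$ is the Euclidean projection onto $K_F$, i.e. the unique minimizer of $\tfrac12(t-\bar t)^2+\tfrac12(v-\bar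 v)^2+\tfrac12\|X-\bar X\|_F^2$ over $(t,v,X)\in K_F$, with $\|\cdot\|_F$ the Frobenius norm. $\Pi_{K_f}(\bar t,\bar v,\bar\lambda)$ is the Euclidean projection onto $K_f$, i.e. the unique minimizer of $\tfrac12(t-\bar t)^2+\tfrac12(v-\bar v)^2+\tfrac12\|\lambda-\bar\lambda\|_2^2$ over $(t,v,\lambda)\in K_f$. *)

theory Defs
  imports "HOL-Analysis.Analysis"
begin

text \<open>
  The index type \<open>'n\<close> of \<open>real ^ 'n\<close> is taken in the sort \<open>{finite, linorder}\<close> so that
  ``nonincreasing order'' of the entries of a vector makes sense.  Functions with values in
  \<open>R \<union> {\<infinity>}\<close> are functions into \<^typ>\<open>ereal\<close> that do not take the value \<open>-\<infinity>\<close>.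
\<close>

definition diag_mat :: "real ^ 'n \<Rightarrow> real ^ 'n ^ 'n"
  where "diag_mat x = (\<chi> i j. if i = j then x $ i else 0)"

definition permutation_matrix :: "real ^ 'n ^ 'n \<Rightarrow> bool"
  where "permutation_matrix P \<longleftrightarrow> (\<exists>p. bij p \<and> P = (\<chi> i j. if j = p i then 1 else 0))"

definition symmetric_fun :: "(real ^ 'n \<Rightarrow> ereal) \<Rightarrow> bool"
  where "symmetric_fun f \<longleftrightarrow> (\<forall>P x. permutation_matrix P \<longrightarrow> f x = f (P *v x))"

text \<open>
  The convention \<open>0 * \<infinity> = 0\<close> of \<^typ>\<open>ereal\<close> makes the endpoint cases \<open>u = 0\<close> and \<open>v = 0\<close> trivial.
\<close>

definition convex_fun :: "('a::real_vector \<Rightarrow> ereal) \<Rightarrow> bool"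
  where "convex_fun f \<longleftrightarrow>
    (\<forall>x y. \<forall>u\<ge>0. \<forall>v\<ge>0. u + v = 1 \<longrightarrow>
      f (u *\<^sub>R x + v *\<^sub>R y) \<le> ereal u * f x + ereal v * f y)"

definition symmetric_matrices :: "(real ^ 'n ^ 'n) set"
  where "symmetric_matrices = {X. transpose X = X}"

text \<open>
  Eigenvalues are listed with multiplicity, i.e. as the roots of the characteristic polynomial
  \<open>det (z I - X)\<close>.  Meaningful for symmetric \<open>X\<close>, all of whose eigenvalues are real.
\<close>

definition eigvals :: "real ^ ('n::{finite, linorder}) ^ ('n::{finite, linorder}) \<Rightarrow> real ^ ('n::{finite, linorder})"
  where "eigvals X = (THE l. (\<forall>i j. i \<le> j \<longrightarrow> l $ j \<le> l $ i) \<and>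
                             (\<forall>z. det (mat z - X) = (\<Prod>i\<in>UNIV. (z - l $ i))))"

definition spectral_fun ::
  "(real ^ ('n::{finite, linorder}) \<Rightarrow> ereal) \<Rightarrow> real ^ ('n::{finite, linorder}) ^ ('n::{finite, linorder}) \<Rightarrow> ereal"
  where "spectral_fun f X = f (eigvals X)"

definition spectral_vector_cone :: "(real ^ 'n \<Rightarrow> ereal) \<Rightarrow> (real \<times> real \<times> (real ^ 'n)) set"
  where "spectral_vector_cone f =
    closure {(t, v, x). 0 < v \<and> ereal v * f (x /\<^sub>R v) \<le> ereal t}"

text \<open>
  The symmetric matrices form a closed subspace, so the closure may be taken among all matrices.
\<close>

definition spectral_matrix_cone ::
  "(real ^ 'n ^ 'n \<Rightarrow> ereal) \<Rightarrow> (real \<times> real \<times> (real ^ 'n ^ 'n)) set"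
  where "spectral_matrix_cone F =
    closure {(t, v, X). 0 < v \<and> X \<in> symmetric_matrices \<and> ereal v * F (X /\<^sub>R v) \<le> ereal t}"

text \<open>
  Euclidean projection is \<^const>\<open>closest_point\<close>: the product metric and the norm on
  \<open>real ^ 'n ^ 'n\<close> are the Euclidean ones, the latter being the Frobenius norm.
\<close>

lemma norm_matrix_Frobenius: "norm (X :: real ^ 'n ^ 'm) = sqrt (\<Sum>i\<in>UNIV. \<Sum>j\<in>UNIV. (X $ i $ j)\<^sup>2)"
  by (simp add: norm_vec_def L2_set_def sum_nonneg)

lemma half_dist_triple:
  "(dist (t', v', x') (t, v, x))\<^sup>2 / 2
    = (t - t')\<^sup>2 / 2 + (v - v')\<^sup>2 / 2 + (norm (x - x'))\<^sup>2 / 2"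
  for t v t' v' :: real and x x' :: "'a::real_normed_vector"
  by (simp add: dist_Pair_Pair dist_real_def dist_norm[of x'] norm_minus_commute[of x'] power2_commute
      add_divide_distrib)

end

theory Submission
  imports Defs "HOL-Computational_Algebra.Polynomial"
begin

text \<open>
  Let \<open>p = (t', v', l')\<close> be the projection of \<open>(t, v, l)\<close> onto the vector cone, and let
  \<open>P = (t', v', U diag(l') U\<^sup>T)\<close>.  The point \<open>P\<close> lies in the matrix cone, because
  \<open>F (U diag(x) U\<^sup>T) = f x\<close> for symmetric \<open>f\<close>, so that \<open>x \<mapsto> U diag(x) U\<^sup>T\<close> carries the set whose
  closure is the vector cone into the set whose closure is the matrix cone.  What remains is the
  variational inequality: the residual of \<open>P\<close> has nonpositive inner product with \<open>Y - P\<close> for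
  every \<open>Y\<close> in the matrix cone.  By the law of cosines this makes \<open>P\<close> the only nearest point.

  By continuity it is enough to treat \<open>Y = (s, w, V diag(m) V\<^sup>T)\<close> in the set before closure.  With
  \<open>c = l - l'\<close> and the orthogonal matrix \<open>W = U\<^sup>T V\<close>, the matrix part of the inner product is
  \<open>\<langle>U diag(c) U\<^sup>T, V diag(m) V\<^sup>T\<rangle> = \<Sum>\<^sub>i\<^sub>j W\<^sub>i\<^sub>j\<^sup>2 c\<^sub>i m\<^sub>j\<close>.  The weights \<open>W\<^sub>i\<^sub>j\<^sup>2\<close> are doubly stochastic,
  and a bilinear form with doubly stochastic weights is at most \<open>\<langle>c, m \<circ> \<sigma>\<rangle>\<close> for some permutation \<open>\<sigma>\<close>
  (\<open>doubly_stochastic_bilinear_le_bijection\<close>).  By symmetry of \<open>f\<close> the triple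
  \<open>(s, w, m \<circ> \<sigma>)\<close> is in the vector cone, which is convex, so the variational inequality of the
  projection \<open>p\<close>, applied to that triple, gives the one for \<open>P\<close>.

  Two facts link this to eigenvalues: every symmetric matrix has the form \<open>V diag(m) V\<^sup>T\<close>
  (\<open>symmetric_matrix_eigendecomposition\<close>), and \<open>eigvals\<close> of that matrix is a rearrangement of \<open>m\<close>
  (\<open>eigvals_conj_diag_mat\<close>).
\<close>

section \<open>Orthogonal diagonalization of real symmetric matrices\<close>

lemma quadratic_nonneg_imp_linear_zero:
  fixes a b :: real
  assumes "\<And>e. 0 \<le> e * a + e\<^sup>2 * b"
  shows "a = 0"
proof (rule ccontr)
  assume "a \<noteq> 0"
  \<comment> \<open>\<open>M\<close> exceeds \<open>b\<close>, so at \<open>e = - a / M\<close> the linear term outweighs the quadratic one.\<close>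
  define M where "M = 1 + \<bar>b\<bar>"
  have M: "M > 0" "b < M" by (auto simp: M_def)
  have "(- a / M) * a + (- a / M)\<^sup>2 * b = - (a\<^sup>2 * (M - b)) / M\<^sup>2"
    using M by (simp add: field_simps power2_eq_square)
  also have "\<dots> < 0"
    using M \<open>a \<noteq> 0\<close> by (simp add: divide_neg_pos)
  finally show False
    using assms[of "- a / M"] by simp
qed

lemma symmetric_matrix_inner:
  fixes Z :: "real ^ 'n ^ 'n"
  assumes "transpose Z = Z"
  shows "(Z *v x) \<bullet> y = x \<bullet> (Z *v y)"
  by (metis assms dot_lmul_matrix transpose_matrix_vector)

text \<open>
  A maximizer \<open>w\<close> of the Rayleigh quotient on the subspace is an eigenvector for the maximal value
  \<open>c\<close>: the form \<open>c \<parallel>y\<parallel>\<^sup>2 - \<langle>y, Z y\<rangle>\<close> is nonnegative on the subspace and vanishes at \<open>w\<close>, hence so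
  does its first variation there, and invariance puts \<open>c w - Z w\<close> among the admissible directions.
\<close>

lemma symmetric_eigenvector_in_invariant_subspace:
  fixes Z :: "real ^ 'n ^ 'n"
  assumes sym: "transpose Z = Z"
    and W: "subspace W" "\<And>x. x \<in> W \<Longrightarrow> Z *v x \<in> W" "W \<noteq> {0}"
  obtains w c where "w \<in> W" "norm w = 1" "Z *v w = c *\<^sub>R w"
proof -
  define S where "S = W \<inter> sphere 0 1"
  define q where "q = (\<lambda>x. x \<bullet> (Z *v x))"
  obtain x where x: "x \<in> W" "x \<noteq> 0"
    using W(1,3) subspace_0 by blast
  have "x /\<^sub>R norm x \<in> S"
    using x W(1) by (auto simp: S_def subspace_scale)
  moreover have "compact S"
    unfolding S_def using W(1) by (intro closed_Int_compact closed_subspace) auto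
  moreover have "continuous_on S q"
    unfolding q_def by (intro continuous_intros linear_continuous_on linear_conv_bounded_linear[THEN iffD1]) auto
  ultimately obtain w where w: "w \<in> S" "\<And>y. y \<in> S \<Longrightarrow> q y \<le> q w"
    using continuous_attains_sup[of S q] by blast
  define c where "c = q w"
  have wW: "w \<in> W" "norm w = 1" using w(1) by (auto simp: S_def)
  define r where "r = c *\<^sub>R w - Z *v w"
  have rW: "r \<in> W"
    using W wW by (simp add: r_def subspace_diff subspace_scale)
  define g where "g = (\<lambda>y. c * (y \<bullet> y) - q y)"
  have g_nonneg: "g y \<ge> 0" if "y \<in> W" for y
  proof (cases "y = 0")
    case True then show ?thesis by (simp add: g_def q_def)
  next
    case False
    have "y /\<^sub>R norm y \<in> S"
      using False that W(1) by (auto simp: S_def subspace_scale)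
    then have "q (y /\<^sub>R norm y) \<le> c" using w(2) c_def by blast
    moreover have "q (y /\<^sub>R norm y) = q y / (y \<bullet> y)"
      by (simp add: q_def matrix_vector_mult_scaleR dot_square_norm power2_eq_square divide_inverse ac_simps)
    moreover have "y \<bullet> y > 0" using False by simp
    ultimately show ?thesis by (simp add: g_def field_simps)
  qed
  have "0 \<le> e * (2 * (r \<bullet> r)) + e\<^sup>2 * g r" for e
  proof -
    have "w + e *\<^sub>R r \<in> W" using W(1) rW wW by (simp add: subspace_add subspace_scale)
    then have "0 \<le> g (w + e *\<^sub>R r)" by (rule g_nonneg)
    also have "g (w + e *\<^sub>R r) = g w + 2 * e * ((c *\<^sub>R w - Z *v w) \<bullet> r) + e\<^sup>2 * g r"
    proof -
      have "w \<bullet> (Z *v r) = (Z *v w) \<bullet> r" using symmetric_matrix_inner[OF sym] by simp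
      then show ?thesis
        by (simp add: g_def q_def matrix_vector_right_distrib matrix_vector_mult_scaleR
            inner_simps inner_commute power2_eq_square algebra_simps)
    qed
    also have "g w = 0"
      using wW by (simp add: g_def c_def dot_square_norm)
    finally show ?thesis by (simp add: r_def[symmetric] algebra_simps)
  qed
  then have "2 * (r \<bullet> r) = 0" by (rule quadratic_nonneg_imp_linear_zero)
  then have "Z *v w = c *\<^sub>R w" by (simp add: r_def)
  with wW that show ?thesis by blast
qed

lemma column_matrix_mult_diag_mat: "column j (V ** diag_mat m) = m $ j *\<^sub>R column j V"
  by (simp add: vec_eq_iff column_def matrix_matrix_mult_def diag_mat_def if_distrib cong: if_cong)

lemma column_matrix_mult: "column j (A ** B) = A *v column j B" for A :: "real ^ 'n ^ 'm"
  by (simp add: vec_eq_iff column_def matrix_matrix_mult_def matrix_vector_mult_def)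

lemma matrix_eq_by_columns: "A = B" if "\<And>j. column j A = column j B"
  using that by (simp add: vec_eq_iff column_def)

text \<open>
  An orthonormal set of eigenvectors of largest cardinality spans: its orthogonal complement is
  invariant because the matrix is symmetric, so a nonzero complement would contain one more
  eigenvector.  Such a set supplies the columns of \<open>V\<close>.
\<close>

theorem symmetric_matrix_eigendecomposition:
  fixes Z :: "real ^ 'n ^ 'n"
  assumes sym: "transpose Z = Z"
  obtains V m where "orthogonal_matrix V" "Z = V ** diag_mat m ** transpose V"
proof -
  define P where "P = (\<lambda>B. finite B \<and> pairwise orthogonal B
      \<and> (\<forall>b\<in>B. norm b = 1 \<and> (\<exists>c. Z *v b = c *\<^sub>R b)))"
  have indep: "independent B" if "P B" for B
    using that by (intro pairwise_orthogonal_independent) (auto simp: P_def)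
  have "P {}" by (simp add: P_def)
  moreover have "card B < Suc CARD('n)" if "P B" for B
    using independent_bound[OF indep[OF that]] by simp
  ultimately obtain B where B: "P B" "\<And>B'. P B' \<Longrightarrow> card B' \<le> card B"
    using ex_has_greatest_nat[of P "{}" card "Suc CARD('n)"] by blast
  have finB: "finite B" and orthB: "pairwise orthogonal B"
    and eigB: "\<And>b. b \<in> B \<Longrightarrow> norm b = 1" "\<And>b. b \<in> B \<Longrightarrow> \<exists>c. Z *v b = c *\<^sub>R b"
    using B(1) by (auto simp: P_def)
  define W where "W = {x. \<forall>b\<in>B. x \<bullet> b = 0}"
  have "W = {0}"
  proof (rule ccontr)
    assume "W \<noteq> {0}"
    moreover have "subspace W"
      by (auto simp: W_def subspace_def inner_simps)
    moreover have "Z *v x \<in> W" if "x \<in> W" for x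
    proof -
      have "(Z *v x) \<bullet> b = 0" if "b \<in> B" for b
        using eigB(2)[OF that] \<open>x \<in> W\<close> that by (auto simp: symmetric_matrix_inner[OF sym] W_def)
      then show ?thesis by (simp add: W_def)
    qed
    ultimately obtain w c where w: "w \<in> W" "norm w = 1" "Z *v w = c *\<^sub>R w"
      using symmetric_eigenvector_in_invariant_subspace[OF sym] by metis
    have "w \<notin> B" using w by (auto simp: W_def)
    moreover have "P (insert w B)"
      using B(1) w by (auto simp: P_def pairwise_insert orthogonal_def W_def inner_commute)
    ultimately show False using B(2)[of "insert w B"] finB by simp
  qed
  have "span B = UNIV"
  proof (rule ccontr)
    assume "span B \<noteq> UNIV"
    then obtain a where "a \<noteq> 0" "\<forall>x\<in>span B. a \<bullet> x = 0"
      using span_not_UNIV_orthogonal by blast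
    then have "a \<in> W" by (auto simp: W_def span_base)
    with \<open>W = {0}\<close> \<open>a \<noteq> 0\<close> show False by blast
  qed
  then have "card B = CARD('n)"
    using dim_eq_card[OF _ indep[OF B(1)], of UNIV] by simp
  then obtain g :: "'n \<Rightarrow> real ^ 'n" where g: "bij_betw g UNIV B"
    using finite_same_card_bij[of "UNIV :: 'n set" B] finB by auto
  have gB: "g j \<in> B" for j using g by (auto simp: bij_betw_def)
  define V where "V = (\<chi> i j. g j $ i)"
  have col: "column j V = g j" for j by (simp add: V_def column_def vec_eq_iff)
  from eigB(2)[OF gB] obtain m' where m': "\<And>j. Z *v g j = m' j *\<^sub>R g j" by metis
  define m :: "real ^ 'n" where "m = (\<chi> j. m' j)"
  have V: "orthogonal_matrix V"
    unfolding orthogonal_matrix_orthonormal_columns col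
    using eigB(1)[OF gB] pairwiseD[OF orthB gB gB] injD[OF bij_betw_imp_inj_on[OF g]] by blast
  have "Z ** V = V ** diag_mat m"
    by (rule matrix_eq_by_columns)
      (simp only: column_matrix_mult_diag_mat, simp add: column_matrix_mult col m' m_def)
  then have "Z ** (V ** transpose V) = V ** diag_mat m ** transpose V"
    by (simp add: matrix_mul_assoc)
  with V have "Z = V ** diag_mat m ** transpose V" by (simp add: orthogonal_matrix_def)
  with V that show ?thesis by blast
qed

section \<open>Bilinear forms with doubly stochastic weights\<close>

text \<open>
  Induction on the size.  Let \<open>i0\<close> and \<open>j0\<close> maximize \<open>a\<close> and \<open>b\<close>.  Moving all the weight of row
  \<open>i0\<close> and of column \<open>j0\<close> to the entry \<open>(i0, j0)\<close>, and compensating each other entry by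
  \<open>D i j0 * D i0 j / (1 - D i0 j0)\<close>, keeps all row and column sums equal to \<open>1\<close>.  It changes the
  value by a combination of the products \<open>(a i0 - a i) * (b j0 - b j)\<close> with nonnegative
  coefficients, so the value does not decrease.  Afterwards the rest is a doubly stochastic array
  of smaller size, and \<open>i0\<close> is matched to \<open>j0\<close>.  This takes the place of Birkhoff's theorem.
\<close>

lemma doubly_stochastic_bilinear_le_bijection:
  fixes D :: "'a \<Rightarrow> 'b \<Rightarrow> real"
  assumes "finite I" "finite J" "card I = card J"
    and "\<And>i j. i \<in> I \<Longrightarrow> j \<in> J \<Longrightarrow> 0 \<le> D i j"
    and "\<And>i. i \<in> I \<Longrightarrow> (\<Sum>j\<in>J. D i j) = 1"
    and "\<And>j. j \<in> J \<Longrightarrow> (\<Sum>i\<in>I. D i j) = 1"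
  shows "\<exists>s. bij_betw s I J \<and> (\<Sum>i\<in>I. \<Sum>j\<in>J. D i j * (a i * b j)) \<le> (\<Sum>i\<in>I. a i * b (s i))"
  using assms
proof (induction "card I" arbitrary: I J D)
  case 0
  then show ?case by (auto simp: bij_betw_def)
next
  case (Suc n)
  note fin = Suc.prems(1,2) and nonneg = Suc.prems(4) and row = Suc.prems(5) and col = Suc.prems(6)
  have ne: "I \<noteq> {}" "J \<noteq> {}" using Suc.hyps(2) Suc.prems(3) by auto
  have "Max (a ` I) \<in> a ` I" "Max (b ` J) \<in> b ` J"
    using fin ne by (intro Max_in; simp)+
  then obtain i0 j0 where "i0 \<in> I" "a i0 = Max (a ` I)" "j0 \<in> J" "b j0 = Max (b ` J)"
    by force
  then have i0: "i0 \<in> I" "\<And>i. i \<in> I \<Longrightarrow> a i \<le> a i0"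
    and j0: "j0 \<in> J" "\<And>j. j \<in> J \<Longrightarrow> b j \<le> b j0"
    using fin by auto
  define I' J' where "I' = I - {i0}" and "J' = J - {j0}"
  have fin': "finite I'" "finite J'" and card': "n = card I'" "card I' = card J'"
    using fin i0 j0 Suc.hyps(2) Suc.prems(3) by (auto simp: I'_def J'_def)
  have sI: "sum h I = h i0 + sum h I'" for h :: "'a \<Rightarrow> real"
    unfolding I'_def using fin i0 by (simp add: sum.remove)
  have sJ: "sum h J = h j0 + sum h J'" for h :: "'b \<Rightarrow> real"
    unfolding J'_def using fin j0 by (simp add: sum.remove)
  have inI: "i \<in> I" if "i \<in> I'" for i using that by (simp add: I'_def)
  have inJ: "j \<in> J" if "j \<in> J'" for j using that by (simp add: J'_def)
  define d where "d = 1 - D i0 j0"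
  have rowd: "(\<Sum>j\<in>J'. D i0 j) = d" using row[OF i0(1)] by (simp add: sJ d_def)
  have cold: "(\<Sum>i\<in>I'. D i j0) = d" using col[OF j0(1)] by (simp add: sI d_def)
  have row': "(\<Sum>j\<in>J'. D i j) = 1 - D i j0" if "i \<in> I'" for i using row[OF inI[OF that]] by (simp add: sJ)
  have col': "(\<Sum>i\<in>I'. D i j) = 1 - D i0 j" if "j \<in> J'" for j using col[OF inJ[OF that]] by (simp add: sI)
  have d0: "0 \<le> d" unfolding rowd[symmetric] using nonneg i0 inJ by (intro sum_nonneg) auto
  have dz: "D i j0 = 0" if "d = 0" "i \<in> I'" for i
    using that cold sum_nonneg_eq_0_iff[OF fin'(1), of "\<lambda>i. D i j0"] nonneg inI j0 by auto
  have dz': "D i0 j = 0" if "d = 0" "j \<in> J'" for j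
    using that rowd sum_nonneg_eq_0_iff[OF fin'(2), of "\<lambda>j. D i0 j"] nonneg inJ i0 by auto
  \<comment> \<open>If \<open>d = 0\<close>, the correction term is zero both by \<open>x / 0 = 0\<close> and in substance: row \<open>i0\<close> and
    column \<open>j0\<close> then have no weight outside \<open>(i0, j0)\<close>.\<close>
  define E where "E = (\<lambda>i j. D i j + D i j0 * D i0 j / d)"
  have E_nonneg: "0 \<le> E i j" if "i \<in> I'" "j \<in> J'" for i j
    unfolding E_def using that nonneg inI inJ i0 j0 d0 by simp
  have E_row: "(\<Sum>j\<in>J'. E i j) = 1" if "i \<in> I'" for i
    unfolding E_def sum.distrib sum_divide_distrib[symmetric] sum_distrib_left[symmetric] rowd row'[OF that]
    using dz[OF _ that] by simp
  have E_col: "(\<Sum>i\<in>I'. E i j) = 1" if "j \<in> J'" for j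
    unfolding E_def sum.distrib sum_divide_distrib[symmetric] sum_distrib_right[symmetric] cold col'[OF that]
    using dz'[OF _ that] by simp
  obtain s where s: "bij_betw s I' J'"
      "(\<Sum>i\<in>I'. \<Sum>j\<in>J'. E i j * (a i * b j)) \<le> (\<Sum>i\<in>I'. a i * b (s i))"
    using Suc.hyps(1)[OF card'(1) fin' card'(2) E_nonneg E_row E_col] by blast
  define s' where "s' = s(i0 := j0)"
  have s'I': "s' i = s i" if "i \<in> I'" for i using that by (auto simp: s'_def I'_def)
  have "bij_betw s' I' J'" using s(1) s'I' bij_betw_cong by metis
  then have "bij_betw s' (I' \<union> {i0}) (J' \<union> {s' i0})"
    by (subst notIn_Un_bij_betw3[symmetric]) (auto simp: I'_def J'_def s'_def)
  then have bij: "bij_betw s' I J"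
    using i0(1) j0(1) by (simp add: I'_def J'_def s'_def insert_absorb)
  have gain: "0 \<le> (\<Sum>i\<in>I'. \<Sum>j\<in>J'. D i j0 * D i0 j / d * ((a i0 - a i) * (b j0 - b j)))"
    using nonneg inI inJ i0 j0 d0 by (intro sum_nonneg mult_nonneg_nonneg divide_nonneg_nonneg) auto
  define A where "A = (\<Sum>i\<in>I'. D i j0 * a i)"
  define C where "C = (\<Sum>j\<in>J'. D i0 j * b j)"
  have expand: "(\<Sum>i\<in>I'. \<Sum>j\<in>J'. D i j0 * D i0 j / d * ((a i0 - a i) * (b j0 - b j)))
      = (a i0 * d - A) * (b j0 * d - C) / d"
  proof -
    have "a i0 * d - A = (\<Sum>i\<in>I'. D i j0 * (a i0 - a i))"
      by (simp add: cold[symmetric] A_def sum_distrib_left sum_subtractf algebra_simps)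
    moreover have "b j0 * d - C = (\<Sum>j\<in>J'. D i0 j * (b j0 - b j))"
      by (simp add: rowd[symmetric] C_def sum_distrib_left sum_subtractf algebra_simps)
    ultimately show ?thesis
      by (simp add: sum_product sum_divide_distrib mult_ac)
  qed
  have crossE: "(\<Sum>i\<in>I'. \<Sum>j\<in>J'. E i j * (a i * b j))
      = (\<Sum>i\<in>I'. \<Sum>j\<in>J'. D i j * (a i * b j)) + A * C / d"
  proof -
    have "A * C / d = (\<Sum>i\<in>I'. \<Sum>j\<in>J'. D i j0 * D i0 j / d * (a i * b j))"
      by (simp add: A_def C_def sum_product sum_divide_distrib mult_ac)
    then show ?thesis by (simp add: E_def sum.distrib distrib_right)
  qed
  have AC: "A = 0" "C = 0" if "d = 0"
    using dz[OF that] dz'[OF that] by (simp_all add: A_def C_def)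
  have prod_div: "(a i0 * d - A) * (b j0 * d - C) / d = a i0 * b j0 * d - a i0 * C - A * b j0 + A * C / d"
    using AC by (cases "d = 0") (simp_all add: field_simps)
  have D00: "D i0 j0 = 1 - d" by (simp add: d_def)
  have "(\<Sum>i\<in>I. \<Sum>j\<in>J. D i j * (a i * b j))
      = D i0 j0 * (a i0 * b j0) + a i0 * C + A * b j0 + (\<Sum>i\<in>I'. \<Sum>j\<in>J'. D i j * (a i * b j))"
    by (simp add: sI sJ sum.distrib A_def C_def sum_distrib_left sum_distrib_right mult_ac)
  also have "\<dots> = a i0 * b j0 - (a i0 * d - A) * (b j0 * d - C) / d
      + (\<Sum>i\<in>I'. \<Sum>j\<in>J'. E i j * (a i * b j))"
    unfolding crossE prod_div D00 by (simp add: algebra_simps)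
  also have "\<dots> \<le> a i0 * b j0 + (\<Sum>i\<in>I'. a i * b (s i))"
    using gain s(2) unfolding expand by simp
  also have "\<dots> = (\<Sum>i\<in>I. a i * b (s' i))"
    by (simp add: sI s'I' cong: sum.cong) (simp add: s'_def)
  finally show ?case using bij by blast
qed

section \<open>Nonincreasing rearrangements and the eigenvalue vector\<close>

lemma prod_linear_factors_eq_imp_rearrangement:
  fixes l m :: "'n::finite \<Rightarrow> real"
  assumes "\<And>z. (\<Prod>i\<in>UNIV. z - l i) = (\<Prod>i\<in>UNIV. z - m i)"
  obtains p where "bij p" "\<And>i. l i = m (p i)"
proof -
  have roots: "proots (\<Prod>i\<in>UNIV. [:- h i, 1:]) = image_mset h (mset_set UNIV)" for h :: "'n \<Rightarrow> real"
    by (subst proots_prod) (simp_all add: sum_unfold_sum_mset)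
  have "poly (\<Prod>i\<in>UNIV. [:- l i, 1:]) = poly (\<Prod>i\<in>UNIV. [:- m i, 1:])"
    using assms by (simp add: fun_eq_iff poly_prod)
  then have "image_mset l (mset_set UNIV) = image_mset m (mset_set UNIV)"
    unfolding roots[symmetric] by (simp add: poly_eq_poly_eq_iff)
  from image_mset_eq_implies_permutes[OF finite this] that show ?thesis
    by (metis UNIV_I permutes_bij)
qed

text \<open>
  Rearrangement preserves the number of indices with value at least \<open>x\<close>.  For a nonincreasing
  family these indices form an initial segment, so if \<open>g i < h i\<close>, the counts for \<open>x = h i\<close> are
  different: at most the number of indices below \<open>i\<close> for \<open>g\<close>, and at least one more for \<open>h\<close>.
\<close>

lemma antimono_rearrangement_unique:
  fixes l m :: "'n::{finite,linorder} \<Rightarrow> real"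
  assumes "antimono l" "antimono m" "bij p" and eq: "\<And>i. l i = m (p i)"
  shows "l i = m i"
proof -
  have card_eq: "card {j. x \<le> l j} = card {j. x \<le> m j}" for x
  proof (rule bij_betw_same_card)
    show "bij_betw p {j. x \<le> l j} {j. x \<le> m j}"
      using \<open>bij p\<close> eq by (auto simp: bij_betw_def inj_on_def bij_def surj_def image_iff)
  qed
  have strict: False
    if "antimono g" "antimono h" "\<And>x. card {j. x \<le> g j} = card {j. x \<le> h j}" "g i < h i"
    for g h :: "'n \<Rightarrow> real"
  proof -
    have "j < i" if "h i \<le> g j" for j
      using antimonoD[OF \<open>antimono g\<close>, of i j] \<open>g i < h i\<close> that by force
    then have "{j. h i \<le> g j} \<subseteq> {..<i}" by blast
    moreover have "{..i} \<subseteq> {j. h i \<le> h j}"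
      using that(2) by (auto simp: antimono_def)
    ultimately have "card {..i} \<le> card {..<i}"
      using that(3) by (metis card_mono finite order_trans)
    moreover have "card {..<i} < card {..i}"
      by (rule psubset_card_mono) auto
    ultimately show False by simp
  qed
  show ?thesis
    using strict[of l m] strict[of m l] assms(1,2) card_eq by force
qed

text \<open>
  Among all permutations \<open>p\<close>, one that maximizes \<open>\<Sum>k. c k * m (p k)\<close> for a fixed strictly
  decreasing \<open>c\<close> sorts \<open>m\<close>, since exchanging two values that are out of order would increase the
  sum.
\<close>

lemma antimono_rearrangement_exists:
  fixes m :: "'n::{finite,linorder} \<Rightarrow> real"
  obtains p :: "'n \<Rightarrow> 'n" where "bij p" "antimono (\<lambda>i. m (p i))"
proof -
  define c where "c = (\<lambda>i. - real (card {..<i::'n}))"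
  define v where "v = (\<lambda>p. \<Sum>k\<in>UNIV. c k * m (p k))"
  have c_less: "c j < c i" if "i < j" for i j
    unfolding c_def using that by (auto intro!: psubset_card_mono)
  have "Max (v ` {p. bij p}) \<in> v ` {p. bij p}"
    by (rule Max_in) (auto intro: bij_id)
  then obtain p where "bij p" and "v p = Max (v ` {p. bij p})" by force
  then have max: "v q \<le> v p" if "bij q" for q using that by simp
  have "m (p j) \<le> m (p i)" if "i < j" for i j
  proof -
    define q where "q = p \<circ> Transposition.transpose i j"
    have split: "v h = c i * m (h i) + c j * m (h j) + (\<Sum>k\<in>UNIV - {i,j}. c k * m (h k))" for h
    proof -
      have "v h = (\<Sum>k\<in>{i,j}. c k * m (h k)) + (\<Sum>k\<in>UNIV - {i,j}. c k * m (h k))"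
        unfolding v_def by (subst sum.subset_diff[of "{i,j}"]) auto
      with \<open>i < j\<close> show ?thesis by simp
    qed
    have "(\<Sum>k\<in>UNIV - {i,j}. c k * m (q k)) = (\<Sum>k\<in>UNIV - {i,j}. c k * m (p k))"
      by (rule sum.cong) (auto simp: q_def Transposition.transpose_def)
    then have "v p - v q = (c i - c j) * (m (p i) - m (p j))"
      using split[of p] split[of q] by (simp add: q_def algebra_simps)
    moreover have "v q \<le> v p"
      using \<open>bij p\<close> by (intro max) (simp add: q_def bij_comp)
    ultimately have "0 \<le> (c i - c j) * (m (p i) - m (p j))" by linarith
    then show ?thesis
      using c_less[OF \<open>i < j\<close>] by (simp add: zero_le_mult_iff)
  qed
  then have "antimono (\<lambda>i. m (p i))"
    by (metis antimonoI order.order_iff_strict)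
  with \<open>bij p\<close> show ?thesis by (rule that)
qed

lemma diag_mat_scaleR: "diag_mat (r *\<^sub>R x) = r *\<^sub>R diag_mat x"
  by (simp add: diag_mat_def vec_eq_iff)

lemma diag_mat_add: "diag_mat (x + y) = diag_mat x + diag_mat y"
  by (simp add: diag_mat_def vec_eq_iff)

lemma transpose_diag_mat [simp]: "transpose (diag_mat x) = diag_mat x"
  by (auto simp: diag_mat_def vec_eq_iff transpose_def)

lemma matrix_add_rdistrib: "(A + B) ** C = A ** C + B ** C"
  by (vector matrix_matrix_mult_def sum.distrib[symmetric] field_simps)

lemma linear_conj_diag_mat: "linear (\<lambda>x. U ** diag_mat x ** transpose U)"
  by (rule linearI)
    (simp_all add: diag_mat_add diag_mat_scaleR matrix_add_ldistrib matrix_add_rdistrib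
      scalar_matrix_assoc matrix_scalar_ac)

lemma charpoly_conj_diag_mat:
  fixes V :: "real ^ 'n ^ 'n"
  assumes "orthogonal_matrix V"
  shows "det (mat z - V ** diag_mat m ** transpose V) = (\<Prod>i\<in>UNIV. z - m $ i)"
proof -
  have VV: "V ** transpose V = mat 1" using assms by (simp add: orthogonal_matrix_def)
  have scalar: "diag_mat (\<chi> i. z) = z *\<^sub>R (mat 1 :: real ^ 'n ^ 'n)" "mat z = z *\<^sub>R (mat 1 :: real ^ 'n ^ 'n)"
    by (simp_all add: mat_def diag_mat_def vec_eq_iff)
  have "V ** diag_mat (\<chi> i. z) ** transpose V = mat z"
    by (simp only: scalar matrix_scalar_ac scalar_matrix_assoc[symmetric] matrix_mul_rid VV)
  then have "mat z - V ** diag_mat m ** transpose V = V ** diag_mat ((\<chi> i. z) - m) ** transpose V"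
    using linear_diff[OF linear_conj_diag_mat[of V], of "\<chi> i. z" m] by simp
  then have "det (mat z - V ** diag_mat m ** transpose V) = det (V ** transpose V) * det (diag_mat ((\<chi> i. z) - m))"
    by (simp add: det_mul)
  also have "\<dots> = (\<Prod>i\<in>UNIV. z - m $ i)"
    unfolding VV by (simp add: det_diagonal diag_mat_def)
  finally show ?thesis .
qed

text \<open>
  This justifies the definite description in \<open>eigvals\<close>: the characteristic polynomial determines
  the diagonal up to a permutation, and only one rearrangement of it is nonincreasing.
\<close>

lemma eigvals_conj_diag_mat:
  fixes V :: "real ^ ('n::{finite,linorder}) ^ ('n::{finite,linorder})"
  assumes "orthogonal_matrix V"
  obtains p where "bij p" "eigvals (V ** diag_mat m ** transpose V) = (\<chi> i. m $ p i)"
proof -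
  obtain p :: "'n \<Rightarrow> 'n" where p: "bij p" "antimono (\<lambda>i. m $ p i)"
    using antimono_rearrangement_exists[of "\<lambda>i. m $ i"] by blast
  have "eigvals (V ** diag_mat m ** transpose V) = (\<chi> i. m $ p i)"
    unfolding eigvals_def charpoly_conj_diag_mat[OF assms]
  proof (rule the_equality, intro conjI allI impI)
    show "(\<chi> i. m $ p i) $ j \<le> (\<chi> i. m $ p i) $ i" if "i \<le> j" for i j
      using p(2) that by (simp add: antimono_def)
    show prod: "(\<Prod>i\<in>UNIV. z - m $ i) = (\<Prod>i\<in>UNIV. z - (\<chi> i. m $ p i) $ i)" for z
      using prod.reindex_bij_betw[OF p(1), of "\<lambda>i. z - m $ i"] by simp
    fix l :: "(real, 'n) vec"
    assume l: "(\<forall>i j. i \<le> j \<longrightarrow> l $ j \<le> l $ i) \<and> (\<forall>z. (\<Prod>i\<in>UNIV. z - m $ i) = (\<Prod>i\<in>UNIV. z - l $ i))"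
    then have "(\<Prod>i\<in>UNIV. z - l $ i) = (\<Prod>i\<in>UNIV. z - m $ p i)" for z
      using prod[of z] by simp
    then obtain q where "bij q" "\<And>i. l $ i = m $ p (q i)"
      using prod_linear_factors_eq_imp_rearrangement[of "\<lambda>i. l $ i" "\<lambda>i. m $ p i"] by blast
    moreover have "antimono (\<lambda>i. l $ i)" using l by (simp add: antimono_def)
    ultimately have "l $ i = m $ p i" for i
      using antimono_rearrangement_unique[of "\<lambda>i. l $ i" "\<lambda>i. m $ p i" q i] p(2) by blast
    then show "l = (\<chi> i. m $ p i)" by (simp add: vec_eq_iff)
  qed
  with p(1) that show ?thesis by blast
qed

lemma symmetric_fun_permute:
  assumes "symmetric_fun f" "bij p"
  shows "f (\<chi> i. x $ p i) = f x"
proof -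
  define P :: "real ^ 'a ^ 'a" where "P = (\<chi> i j. if j = p i then 1 else 0)"
  have "permutation_matrix P" using assms(2) by (auto simp: permutation_matrix_def P_def)
  moreover have "P *v x = (\<chi> i. x $ p i)"
    by (simp add: P_def matrix_vector_mult_def if_distrib[of "\<lambda>a. a * _"] cong: if_cong)
  ultimately show ?thesis using assms(1) by (metis symmetric_fun_def)
qed

lemma spectral_fun_conj_diag_mat:
  fixes V :: "real ^ ('n::{finite,linorder}) ^ ('n::{finite,linorder})"
  assumes "symmetric_fun f" "orthogonal_matrix V"
  shows "spectral_fun f (V ** diag_mat m ** transpose V) = f m"
proof -
  obtain p where "bij p" "eigvals (V ** diag_mat m ** transpose V) = (\<chi> i. m $ p i)"
    by (rule eigvals_conj_diag_mat[OF assms(2)])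
  then show ?thesis
    by (simp add: spectral_fun_def symmetric_fun_permute[OF assms(1)])
qed

section \<open>The Frobenius inner product of orthogonally diagonalized matrices\<close>

text \<open>
  Multiplication by a fixed matrix, from the left or from the right, has multiplication by its
  transpose as adjoint.
\<close>

lemma inner_matrix_mult_left: "(A ** B) \<bullet> C = B \<bullet> (transpose A ** C)"
  for A :: "real ^ 'k ^ 'm" and B :: "real ^ 'n ^ 'k" and C :: "real ^ 'n ^ 'm"
proof -
  have "(A ** B) \<bullet> C = (\<Sum>i\<in>UNIV. \<Sum>j\<in>UNIV. \<Sum>k\<in>UNIV. A $ i $ k * B $ k $ j * C $ i $ j)"
    by (simp add: inner_vec_def matrix_matrix_mult_def sum_distrib_right)
  also have "\<dots> = (\<Sum>i\<in>UNIV. \<Sum>k\<in>UNIV. \<Sum>j\<in>UNIV. A $ i $ k * B $ k $ j * C $ i $ j)"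
    by (intro sum.cong refl sum.swap)
  also have "\<dots> = (\<Sum>k\<in>UNIV. \<Sum>i\<in>UNIV. \<Sum>j\<in>UNIV. A $ i $ k * B $ k $ j * C $ i $ j)"
    by (rule sum.swap)
  also have "\<dots> = (\<Sum>k\<in>UNIV. \<Sum>j\<in>UNIV. \<Sum>i\<in>UNIV. A $ i $ k * B $ k $ j * C $ i $ j)"
    by (intro sum.cong refl sum.swap)
  also have "\<dots> = B \<bullet> (transpose A ** C)"
    by (simp add: inner_vec_def matrix_matrix_mult_def sum_distrib_left transpose_def mult_ac)
  finally show ?thesis .
qed

lemma inner_transpose: "transpose A \<bullet> transpose B = A \<bullet> B" for A B :: "real ^ 'n ^ 'm"
  by (simp add: inner_vec_def transpose_def) (rule sum.swap)

lemma inner_matrix_mult_right: "(A ** B) \<bullet> C = A \<bullet> (C ** transpose B)"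
  for A :: "real ^ 'k ^ 'm" and B :: "real ^ 'n ^ 'k" and C :: "real ^ 'n ^ 'm"
proof -
  have "(A ** B) \<bullet> C = (transpose B ** transpose A) \<bullet> transpose C"
    by (simp add: inner_transpose flip: matrix_transpose_mul)
  also have "\<dots> = A \<bullet> (C ** transpose B)"
    unfolding inner_matrix_mult_left
    by (metis inner_transpose matrix_transpose_mul transpose_transpose)
  finally show ?thesis .
qed

lemma inner_conj_diag_mat:
  fixes U V :: "real ^ 'n ^ 'n"
  defines "W \<equiv> transpose U ** V"
  shows "(U ** diag_mat c ** transpose U) \<bullet> (V ** diag_mat m ** transpose V)
    = (\<Sum>i\<in>UNIV. \<Sum>j\<in>UNIV. (W $ i $ j)\<^sup>2 * (c $ i * m $ j))"
proof -
  have diag: "(W ** diag_mat m ** transpose W) $ i $ i = (\<Sum>j\<in>UNIV. (W $ i $ j)\<^sup>2 * m $ j)" for i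
    by (simp add: matrix_matrix_mult_def diag_mat_def transpose_def if_distrib[of "\<lambda>a. _ * a"]
        power2_eq_square mult_ac cong: if_cong)
  have "(U ** diag_mat c ** transpose U) \<bullet> (V ** diag_mat m ** transpose V)
      = diag_mat c \<bullet> (W ** diag_mat m ** transpose W)"
    by (simp add: inner_matrix_mult_right[of "U ** diag_mat c"] inner_matrix_mult_left[of U "diag_mat c"]
        W_def matrix_transpose_mul matrix_mul_assoc)
  also have "\<dots> = (\<Sum>i\<in>UNIV. c $ i * (W ** diag_mat m ** transpose W) $ i $ i)"
    by (simp add: inner_vec_def diag_mat_def if_distrib[of "\<lambda>a. a * _"] cong: if_cong)
  finally show ?thesis by (simp add: diag sum_distrib_left mult_ac)
qed

lemma sum_squares_row_orthogonal_matrix: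
  fixes W :: "real ^ 'n ^ 'n"
  assumes "orthogonal_matrix W"
  shows "(\<Sum>j\<in>UNIV. (W $ i $ j)\<^sup>2) = 1"
proof -
  have "(W ** transpose W) $ i $ i = 1" using assms by (simp add: orthogonal_matrix_def mat_def)
  then show ?thesis by (simp add: matrix_matrix_mult_def transpose_def power2_eq_square)
qed

text \<open>
  A form of the trace inequality of von Neumann.  The squared entries of an orthogonal matrix are
  doubly stochastic, so the weights between the two diagonals can be replaced by a permutation.
\<close>

lemma inner_conj_diag_mat_le_rearrangement:
  fixes U V :: "real ^ 'n ^ 'n"
  assumes "orthogonal_matrix U" "orthogonal_matrix V"
  obtains s where "bij s"
    "(U ** diag_mat c ** transpose U) \<bullet> (V ** diag_mat m ** transpose V) \<le> c \<bullet> (\<chi> i. m $ s i)"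
proof -
  define W where "W = transpose U ** V"
  have W: "orthogonal_matrix W"
    unfolding W_def using assms by (simp add: orthogonal_matrix_mul)
  have "(\<Sum>i\<in>UNIV. (W $ i $ j)\<^sup>2) = 1" for j
    using sum_squares_row_orthogonal_matrix[of "transpose W" j] orthogonal_matrix_transpose[of W] W
    by (simp add: transpose_def del: orthogonal_matrix_transpose)
  then obtain s where "bij s"
      "(\<Sum>i\<in>UNIV. \<Sum>j\<in>UNIV. (W $ i $ j)\<^sup>2 * (c $ i * m $ j)) \<le> (\<Sum>i\<in>UNIV. c $ i * m $ s i)"
    using doubly_stochastic_bilinear_le_bijection[of "UNIV :: 'n set" "UNIV :: 'n set" "\<lambda>i j. (W $ i $ j)\<^sup>2" "\<lambda>i. c $ i" "\<lambda>j. m $ j"]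
      sum_squares_row_orthogonal_matrix[OF W] by auto
  then show ?thesis
    using that[of s] inner_conj_diag_mat[of U c V m] by (simp add: W_def inner_vec_def[of c])
qed

lemma inner_conj_diag_mat_same:
  fixes U :: "real ^ 'n ^ 'n"
  assumes "orthogonal_matrix U"
  shows "(U ** diag_mat x ** transpose U) \<bullet> (U ** diag_mat y ** transpose U) = x \<bullet> y"
proof -
  have "transpose U ** U = mat 1" using assms by (simp add: orthogonal_matrix_def)
  then show ?thesis
    unfolding inner_conj_diag_mat
    by (simp add: mat_def inner_vec_def if_distrib[of "\<lambda>a. a\<^sup>2"]
        if_distrib[of "\<lambda>a. a * _"] cong: if_cong)
qed

section \<open>Projections onto the two cones\<close>

text \<open>
  The argument of \<open>f\<close> at the convex combination \<open>a *\<^sub>R (t1, v1, x1) + b *\<^sub>R (t2, v2, x2)\<close> is itself a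
  convex combination of \<open>x1 /\<^sub>R v1\<close> and \<open>x2 /\<^sub>R v2\<close>, with weights \<open>a * v1 / v\<close> and \<open>b * v2 / v\<close> for
  \<open>v = a * v1 + b * v2\<close>.
\<close>

lemma convex_perspective_epigraph:
  fixes f :: "'a::real_vector \<Rightarrow> ereal"
  assumes conv: "convex_fun f" and "\<And>x. f x \<noteq> -\<infinity>"
  shows "convex {(t, v, x). 0 < v \<and> ereal v * f (x /\<^sub>R v) \<le> ereal t}"
proof (rule convexI, clarsimp)
  fix t1 v1 x1 t2 v2 x2 and a b :: real
  assume *: "0 < v1" "ereal v1 * f (x1 /\<^sub>R v1) \<le> ereal t1"
    "0 < v2" "ereal v2 * f (x2 /\<^sub>R v2) \<le> ereal t2" "0 \<le> a" "0 \<le> b" "a + b = 1"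
  define v where "v = a * v1 + b * v2"
  have v: "v > 0"
    using * unfolding v_def by (cases "a = 0") (simp_all add: add_pos_nonneg)
  have fin: "\<exists>r. f (x /\<^sub>R w) = ereal r \<and> w * r \<le> t"
    if "0 < w" "ereal w * f (x /\<^sub>R w) \<le> ereal t" for x and w t :: real
    using that assms(2)[of "x /\<^sub>R w"] by (cases "f (x /\<^sub>R w)") auto
  obtain r1 where r1: "f (x1 /\<^sub>R v1) = ereal r1" "v1 * r1 \<le> t1" using fin * by blast
  obtain r2 where r2: "f (x2 /\<^sub>R v2) = ereal r2" "v2 * r2 \<le> t2" using fin * by blast
  have "(a *\<^sub>R x1 + b *\<^sub>R x2) /\<^sub>R v
      = (a * v1 / v) *\<^sub>R (x1 /\<^sub>R v1) + (b * v2 / v) *\<^sub>R (x2 /\<^sub>R v2)"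
  proof -
    have "a * v1 / v * inverse v1 = inverse v * a" "b * v2 / v * inverse v2 = inverse v * b"
      using * by (simp_all add: field_simps)
    then show ?thesis by (simp add: scaleR_add_right del: inverse_eq_divide)
  qed
  also have "f \<dots> \<le> ereal (a * v1 / v) * f (x1 /\<^sub>R v1) + ereal (b * v2 / v) * f (x2 /\<^sub>R v2)"
  proof -
    have "a * v1 / v + b * v2 / v = 1"
      using v by (simp add: v_def flip: add_divide_distrib)
    then show ?thesis using conv * v unfolding convex_fun_def
      by (simp del: scaleR_scaleR)
  qed
  also have "\<dots> = ereal ((a * (v1 * r1) + b * (v2 * r2)) / v)"
    by (simp add: r1 r2 add_divide_distrib)
  finally have "ereal v * f ((a *\<^sub>R x1 + b *\<^sub>R x2) /\<^sub>R v)
      \<le> ereal v * ereal ((a * (v1 * r1) + b * (v2 * r2)) / v)"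
    using v by (intro ereal_mult_left_mono) auto
  also have "\<dots> = ereal (a * (v1 * r1) + b * (v2 * r2))" using v by simp
  also have "\<dots> \<le> ereal (a * t1 + b * t2)"
    using * r1 r2 by (simp add: add_mono mult_left_mono)
  finally show "0 < a * v1 + b * v2 \<and>
      ereal (a * v1 + b * v2) * f ((a *\<^sub>R x1 + b *\<^sub>R x2) /\<^sub>R (a * v1 + b * v2)) \<le> ereal (a * t1 + b * t2)"
    using v by (simp add: v_def)
qed

text \<open>
  The variational inequality gives \<open>dist a p ^ 2 + dist p y ^ 2 \<le> dist a y ^ 2\<close> for all \<open>y \<in> S\<close>, so
  \<open>p\<close> is nearest to \<open>a\<close> and no other point of \<open>S\<close> is.
\<close>

lemma closest_point_eqI:
  fixes a p :: "'a::euclidean_space"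
  assumes "p \<in> S" and var: "\<And>y. y \<in> S \<Longrightarrow> (a - p) \<bullet> (y - p) \<le> 0"
  shows "closest_point S a = p"
proof -
  have gap: "(dist a p)\<^sup>2 + (dist p y)\<^sup>2 \<le> (dist a y)\<^sup>2" if "y \<in> S" for y
  proof -
    have "(dist a y)\<^sup>2 = (dist a p)\<^sup>2 + (dist p y)\<^sup>2 - 2 * ((a - p) \<bullet> (y - p))"
      by (simp add: dist_norm power2_norm_eq_inner inner_simps inner_commute)
    with var[OF that] show ?thesis by simp
  qed
  show ?thesis
    unfolding closest_point_def
  proof (rule some_equality)
    show "p \<in> S \<and> (\<forall>y\<in>S. dist a p \<le> dist a y)"
      using gap \<open>p \<in> S\<close> by (smt (verit) power2_le_imp_le zero_le_dist zero_le_power2)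
    show "y = p" if "y \<in> S \<and> (\<forall>z\<in>S. dist a y \<le> dist a z)" for y
    proof -
      have "(dist a y)\<^sup>2 \<le> (dist a p)\<^sup>2"
        using that \<open>p \<in> S\<close> by (simp add: power_mono)
      with gap[of y] that have "(dist p y)\<^sup>2 \<le> 0" by linarith
      then show ?thesis by simp
    qed
  qed
qed

text \<open>
  The variational inequality at a point of the matrix cone is inherited from the vector cone at the
  eigenvalues of that point, listed in the order given by
  \<open>inner_conj_diag_mat_le_rearrangement\<close> for the spectrum \<open>l - l'\<close> of the residual.
\<close>

theorem closest_point_spectral_matrix_cone:
  fixes f :: "real ^ ('n::{finite, linorder}) \<Rightarrow> ereal"
    and U :: "real ^ ('n::{finite, linorder}) ^ ('n::{finite, linorder})"
  assumes proper: "\<And>x. f x \<noteq> -\<infinity>" "\<exists>x. f x \<noteq> \<infinity>"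
    and sym: "symmetric_fun f"
    and conv: "convex_fun f"
    and U: "orthogonal_matrix U"
    and proj: "closest_point (spectral_vector_cone f) (t, v, l) = (t', v', l')"
  shows "closest_point (spectral_matrix_cone (spectral_fun f)) (t, v, U ** diag_mat l ** transpose U)
    = (t', v', U ** diag_mat l' ** transpose U)"
proof (rule closest_point_eqI)
  let ?\<Phi> = "\<lambda>(t, v, x). (t, v, U ** diag_mat x ** transpose U)"
  define E where "E = {(t, v, x). 0 < v \<and> ereal v * f (x /\<^sub>R v) \<le> ereal t}"
  define M where "M = {(t, v, X). 0 < v \<and> X \<in> symmetric_matrices
      \<and> ereal v * spectral_fun f (X /\<^sub>R v) \<le> ereal t}"
  have Kf: "spectral_vector_cone f = closure E" and KF: "spectral_matrix_cone (spectral_fun f) = closure M"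
    by (simp_all add: spectral_vector_cone_def E_def spectral_matrix_cone_def M_def)
  have scale: "(V ** diag_mat m ** transpose V) /\<^sub>R w = V ** diag_mat (m /\<^sub>R w) ** transpose V"
    for V :: "((real, 'n) vec, 'n) vec" and m w
    using linear_scale[OF linear_conj_diag_mat[of V]] by metis
  have M_iff: "(s, w, V ** diag_mat m ** transpose V) \<in> M \<longleftrightarrow> (s, w, m) \<in> E"
    if "orthogonal_matrix V" for s w V m
    by (simp add: M_def E_def symmetric_matrices_def matrix_transpose_mul matrix_mul_assoc
        scale spectral_fun_conj_diag_mat[OF sym that])
  obtain x r where "f x = ereal r"
    using proper by (metis ereal_cases)
  then have "(r, 1, x) \<in> E" by (simp add: E_def)
  then have "closure E \<noteq> {}" by auto
  then have mem: "(t', v', l') \<in> closure E"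
    using closest_point_in_set[of "closure E" "(t, v, l)"] proj by (simp add: Kf)
  have var: "((t, v, l) - (t', v', l')) \<bullet> (y - (t', v', l')) \<le> 0" if "y \<in> closure E" for y
    using closest_point_dot[of "closure E" y "(t, v, l)"] convex_perspective_epigraph[OF conv proper(1)] that proj
    by (simp add: Kf E_def)
  \<comment> \<open>Lifting along \<open>U\<close> maps \<open>E\<close> into \<open>M\<close>, hence closure into closure.\<close>
  have "continuous_on (closure E) ?\<Phi>"
    unfolding case_prod_beta
    by (intro continuous_intros linear_continuous_on_compose[OF _ linear_conj_diag_mat])
  moreover have "?\<Phi> ` E \<subseteq> M"
    using M_iff[OF U] by auto
  ultimately have "?\<Phi> ` closure E \<subseteq> closure M"
    by (meson closed_closure closure_subset image_closure_subset order_trans)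
  with mem show "(t', v', U ** diag_mat l' ** transpose U) \<in> spectral_matrix_cone (spectral_fun f)"
    unfolding KF by force

  let ?a = "(t, v, U ** diag_mat l ** transpose U) - (t', v', U ** diag_mat l' ** transpose U)"
  let ?p = "(t', v', U ** diag_mat l' ** transpose U)"
  \<comment> \<open>The inequality is closed in \<open>y\<close>, so it suffices to prove it on \<open>M\<close>, where each point has an
    explicit spectrum.\<close>
  have "?a \<bullet> (y - ?p) \<le> 0" if "y \<in> M" for y
  proof -
    obtain s w Z where y: "y = (s, w, Z)" by (cases y)
    with that have "transpose Z = Z" by (simp add: M_def symmetric_matrices_def)
    then obtain V m where V: "orthogonal_matrix V" and Z: "Z = V ** diag_mat m ** transpose V"
      by (rule symmetric_matrix_eigendecomposition)
    obtain \<sigma> where "bij \<sigma>" and le: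
      "(U ** diag_mat (l - l') ** transpose U) \<bullet> (V ** diag_mat m ** transpose V)
        \<le> (l - l') \<bullet> (\<chi> i. m $ \<sigma> i)"
      by (rule inner_conj_diag_mat_le_rearrangement[OF U V])
    have "(s, w, m) \<in> E"
      using that M_iff[OF V] by (simp add: y Z)
    moreover have "(\<chi> i. m $ \<sigma> i) /\<^sub>R w = (\<chi> i. (m /\<^sub>R w) $ \<sigma> i)"
      by (simp add: vec_eq_iff)
    ultimately have "(s, w, \<chi> i. m $ \<sigma> i) \<in> E"
      using symmetric_fun_permute[OF sym \<open>bij \<sigma>\<close>, of "m /\<^sub>R w"] by (simp add: E_def)
    then have "((t, v, l) - (t', v', l')) \<bullet> ((s, w, \<chi> i. m $ \<sigma> i) - (t', v', l')) \<le> 0"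
      by (intro var) (rule closure_subset[THEN subsetD])
    moreover have "?a \<bullet> (y - ?p)
        = (t - t') * (s - t') + (v - v') * (w - v')
          + ((U ** diag_mat (l - l') ** transpose U) \<bullet> Z - (l - l') \<bullet> l')"
      using linear_diff[OF linear_conj_diag_mat[of U], of l l'] inner_conj_diag_mat_same[OF U, of "l - l'" l']
      by (simp add: y inner_diff_right)
    ultimately show ?thesis
      using le by (simp add: Z inner_diff_right)
  qed
  then have "M \<subseteq> {y. ?a \<bullet> (y - ?p) \<le> 0}" by blast
  moreover have "closed {y. ?a \<bullet> (y - ?p) \<le> 0}"
    by (intro closed_Collect_le continuous_intros)
  ultimately have "closure M \<subseteq> {y. ?a \<bullet> (y - ?p) \<le> 0}"
    by (rule closure_minimal)
  then show "?a \<bullet> (y - ?p) \<le> 0" if "y \<in> spectral_matrix_cone (spectral_fun f)" for y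
    using that unfolding KF by blast
qed

theorem theorem1:
  fixes f :: "real ^ ('n::{finite, linorder}) \<Rightarrow> ereal"
    and F :: "real ^ ('n::{finite, linorder}) ^ ('n::{finite, linorder}) \<Rightarrow> ereal"
    and t v :: real and X U :: "real ^ ('n::{finite, linorder}) ^ ('n::{finite, linorder})" and l :: "real ^ ('n::{finite, linorder})"
  assumes "\<And>x. f x \<noteq> -\<infinity>"
    and "symmetric_fun f"
    and "convex_fun f"
    and "\<exists>x. f x \<noteq> \<infinity>"
    and "F = spectral_fun f"
    and "orthogonal_matrix U"
    and "X = U ** diag_mat l ** transpose U"
  shows "fst (closest_point (spectral_matrix_cone F) (t, v, X))
           = fst (closest_point (spectral_vector_cone f) (t, v, l)) \<and>
         fst (snd (closest_point (spectral_matrix_cone F) (t, v, X)))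
           = fst (snd (closest_point (spectral_vector_cone f) (t, v, l))) \<and>
         snd (snd (closest_point (spectral_matrix_cone F) (t, v, X)))
           = U ** diag_mat (snd (snd (closest_point (spectral_vector_cone f) (t, v, l))))
               ** transpose U"
proof -
  obtain t' v' l' where proj: "closest_point (spectral_vector_cone f) (t, v, l) = (t', v', l')"
    by (metis prod_cases3)
  show ?thesis
    using closest_point_spectral_matrix_cone[OF assms(1,4,2,3,6) proj] proj assms(5,7) by simp
qed

end
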